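(* Let $n\in\mathbb{N}$, $n>1$, and let $h\in\mathcal{I}$. Then $$d^{(n)}_{(h,\cdot)}(x,y)=\begin{cases}0&\text{for }x=y,\\ 1-h(\gcd(x,n))\cdot h(\gcd(y,n))&\text{for }x\ne y,\end{cases}\qquad x,y\in\mathbb{Z},$$ is a pseudometric on $\mathbb{Z}$, and so also on $D_n$. If $h\in\mathcal{I}_1$, then $d^{(n)}_{(h,\cdot)}$ is a metric on $D_n$.
   Context: $\mathbb{N}$ is the set of positive integers and $D_n=\{x\in\mathbb{N}: x\mid n\}$. A function $h:\mathbb{N}\to\mathbb{R}$ is multiplicative if $h$ is not identically zero and $h(xy)=h(x)h(y)$ for all coprime $x,y\in\mathbb{N}$. $\mathcal{I}$ is the set of multiplicative $h$ with $0\le h(x)\le1$ for all $x>1$; $\mathcal{I}_1$ is the set of $h\in\mathcal{I}$ with $0\le h(x)<1$ for all $x>1$. A pseudometric on $S$ is a function $d:S\times S\to\mathbb{R}$ with $d(x,x)=0$, $d(x,y)=d(y,x)$ and $d(x,z)\le d(x,y)+d(y,z)$; it is a metric if moreover $d(x,y)=0\Rightarrow x=y$. *)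

theory Defs
  imports "HOL-Analysis.Abstract_Metric_Spaces"
begin

text \<open>
  Functions on the positive integers are rendered as functions \<open>nat \<Rightarrow> real\<close>;
  their value at \<open>0\<close> is unconstrained and never used.
\<close>

definition multiplicative :: "(nat \<Rightarrow> real) \<Rightarrow> bool" where
  "multiplicative h \<longleftrightarrow>
     (\<exists>x>0. h x \<noteq> 0) \<and>
     (\<forall>x>0. \<forall>y>0. coprime x y \<longrightarrow> h (x * y) = h x * h y)"

definition mult_I :: "(nat \<Rightarrow> real) set" where
  "mult_I = {h. multiplicative h \<and> (\<forall>x>1. 0 \<le> h x \<and> h x \<le> 1)}"

definition mult_I1 :: "(nat \<Rightarrow> real) set" where
  "mult_I1 = {h \<in> mult_I. \<forall>x>1. 0 \<le> h x \<and> h x < 1}"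

definition divisors_of :: "nat \<Rightarrow> nat set" where
  "divisors_of n = {x. 0 < x \<and> x dvd n}"

definition pseudometric_on :: "'a set \<Rightarrow> ('a \<Rightarrow> 'a \<Rightarrow> real) \<Rightarrow> bool" where
  "pseudometric_on S d \<longleftrightarrow>
     (\<forall>x\<in>S. d x x = 0) \<and>
     (\<forall>x\<in>S. \<forall>y\<in>S. d x y = d y x) \<and>
     (\<forall>x\<in>S. \<forall>y\<in>S. \<forall>z\<in>S. d x z \<le> d x y + d y z)"

definition metric_on :: "'a set \<Rightarrow> ('a \<Rightarrow> 'a \<Rightarrow> real) \<Rightarrow> bool" where
  "metric_on S d \<longleftrightarrow>
     pseudometric_on S d \<and> (\<forall>x\<in>S. \<forall>y\<in>S. d x y = 0 \<longrightarrow> x = y)"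

text \<open>
  The locale \<open>Metric_space\<close> also demands nonnegativity and symmetry outside the carrier,
  whereas the notion above only looks at the carrier; up to that they agree.
\<close>

lemma metric_on_iff_Metric_space:
  "metric_on S d \<longleftrightarrow> Metric_space S (\<lambda>x y. if x \<in> S \<and> y \<in> S then d x y else 0)"
proof
  assume m: "metric_on S d"
  have nonneg: "0 \<le> d x y" if "x \<in> S" "y \<in> S" for x y
  proof -
    have "d x x \<le> d x y + d y x" "d x x = 0" "d x y = d y x"
      using m that unfolding metric_on_def pseudometric_on_def by blast+
    then show ?thesis by linarith
  qed
  show "Metric_space S (\<lambda>x y. if x \<in> S \<and> y \<in> S then d x y else 0)"
    by unfold_locales
      (use m nonneg in \<open>auto simp: metric_on_def pseudometric_on_def\<close>)
next
  assume "Metric_space S (\<lambda>x y. if x \<in> S \<and> y \<in> S then d x y else 0)"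
  then interpret Metric_space S "\<lambda>x y. if x \<in> S \<and> y \<in> S then d x y else 0" .
  have "d x x = 0" if "x \<in> S" for x
    using zero[OF that that] that by simp
  moreover have "d x y = d y x" if "x \<in> S" "y \<in> S" for x y
    using commute[of x y] that by simp
  moreover have "d x z \<le> d x y + d y z" if "x \<in> S" "y \<in> S" "z \<in> S" for x y z
    using triangle[OF that] that by simp
  moreover have "x = y" if "x \<in> S" "y \<in> S" "d x y = 0" for x y
    using zero[OF that(1,2)] that by simp
  ultimately show "metric_on S d"
    unfolding metric_on_def pseudometric_on_def by blast
qed

definition dist_mult :: "(nat \<Rightarrow> real) \<Rightarrow> nat \<Rightarrow> int \<Rightarrow> int \<Rightarrow> real" where
  "dist_mult h n x y =
     (if x = y then 0
      else 1 - h (nat (gcd x (int n))) * h (nat (gcd y (int n))))"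

end

theory Submission
  imports Defs
begin

text \<open>Write g(x) = h(gcd(x,n)), so that distinct points have distance 1 - g(x) g(y). All
  values of g lie in [0,1] (\<open>mult_I_bounds\<close>), and the triangle inequality then becomes
  an inequality between three real numbers, \<open>unit_interval_triangle\<close>. On divisors of n
  the gcd disappears, g(x) = h(x). Distance 0 between distinct divisors would mean h(x) h(y) = 1,
  hence h(x) = h(y) = 1; for h in \<open>mult_I1\<close> this happens only at x = y = 1, a
  contradiction.\<close>

lemma multiplicative_1:
  assumes "multiplicative h"
  shows "h 1 = 1"
proof -
  obtain x where x: "x > 0" "h x \<noteq> 0"
    using assms unfolding multiplicative_def by blast
  have "h (x * 1) = h x * h 1"
    using assms x(1) coprime_1_right zero_less_one unfolding multiplicative_def by blast
  with x(2) show ?thesis by simp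
qed

text \<open>The definition of \<open>mult_I\<close> bounds h only beyond 1; the remaining value h(1)
  = 1 comes from multiplicativity.\<close>

lemma mult_I_bounds:
  assumes "h \<in> mult_I" and "x > 0"
  shows "0 \<le> h x" and "h x \<le> 1"
proof -
  have "x = 1 \<or> x > 1" using assms(2) by linarith
  then show "0 \<le> h x" "h x \<le> 1"
    using assms(1) multiplicative_1[of h] unfolding mult_I_def by auto
qed

lemma mult_I1_eq_1_iff:
  assumes "h \<in> mult_I1" and "x > 0"
  shows "h x = 1 \<longleftrightarrow> x = 1"
proof -
  have "h 1 = 1"
    using assms(1) multiplicative_1 unfolding mult_I1_def mult_I_def by blast
  moreover have "h x < 1" if "x > 1"
    using assms(1) that unfolding mult_I1_def by blast
  ultimately show ?thesis
    using assms(2) by (metis less_irrefl less_one linorder_neqE_nat)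
qed

text \<open>The claim rearranges to b(a + c) \<le> 1 + ac, which follows from b(a + c) \<le> a + c
  \<le> 1 + ac; the second inequality is (1 - a)(1 - c) \<ge> 0.\<close>

lemma unit_interval_triangle:
  fixes a b c :: real
  assumes "0 \<le> a" "a \<le> 1" "b \<le> 1" "0 \<le> c" "c \<le> 1"
  shows "1 - a * c \<le> (1 - a * b) + (1 - b * c)"
proof -
  have "b * (a + c) \<le> a + c"
    using mult_right_mono[of b 1 "a + c"] assms by simp
  moreover have "0 \<le> (1 - a) * (1 - c)"
    using assms by simp
  ultimately show ?thesis by (simp add: algebra_simps)
qed

text \<open>A product of two numbers in [0,1] is at most each factor, so 1 = ab \<le> a \<le> 1, and
  likewise for b.\<close>

lemma mult_eq_1_unit_interval:
  fixes a b :: real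
  assumes "0 \<le> a" "a \<le> 1" "0 \<le> b" "b \<le> 1" "a * b = 1"
  shows "a = 1" and "b = 1"
  using mult_left_le[of b a] mult_left_le[of a b] assms by (simp_all add: mult.commute)

lemma pseudometric_on_subset:
  assumes "pseudometric_on S d" and "T \<subseteq> S"
  shows "pseudometric_on T d"
  using assms unfolding pseudometric_on_def by blast

lemma pseudometric_dist_mult:
  assumes "n > 0" and "h \<in> mult_I"
  shows "pseudometric_on UNIV (dist_mult h n)"
proof -
  define g where "g x = h (nat (gcd x (int n)))" for x
  \<comment> \<open>Since n > 0, the gcd is positive even at x = 0, so h is never evaluated at
    0.\<close>
  have g: "0 \<le> g x" "g x \<le> 1" for x
    using mult_I_bounds[OF assms(2), of "nat (gcd x (int n))"] assms(1)
    by (auto simp: g_def)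
  have d: "dist_mult h n x y = (if x = y then 0 else 1 - g x * g y)" for x y
    by (simp add: dist_mult_def g_def)
  \<comment> \<open>The real inequality settles three distinct points. If x = z differs from y,
    nonnegativity of the distance is needed, which is g(x) g(y) \<le> 1.\<close>
  have "dist_mult h n x z \<le> dist_mult h n x y + dist_mult h n y z" for x y z
    using unit_interval_triangle[of "g x" "g y" "g z"]
      mult_le_one[of "g x" "g y"] mult_le_one[of "g y" "g x"] g
    by (auto simp add: d mult.commute)
  then show ?thesis
    unfolding pseudometric_on_def by (simp add: d mult.commute)
qed

lemma dist_mult_eq_0_imp_eq:
  assumes "h \<in> mult_I1" and x: "x \<in> divisors_of n" and y: "y \<in> divisors_of n"
    and "dist_mult h n (int x) (int y) = 0"
  shows "x = y"
proof (rule ccontr)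
  assume "x \<noteq> y"
  have gcds: "nat (gcd (int x) (int n)) = x" "nat (gcd (int y) (int n)) = y"
    using x y by (simp_all add: divisors_of_def gcd_nat.absorb1)
  have pos: "x > 0" "y > 0"
    using x y by (simp_all add: divisors_of_def)
  have "h \<in> mult_I"
    using assms(1) by (simp add: mult_I1_def)
  moreover have "h x * h y = 1"
    using assms(4) \<open>x \<noteq> y\<close> by (simp only: dist_mult_def gcds) simp
  ultimately have "h x = 1" "h y = 1"
    using mult_eq_1_unit_interval[of "h x" "h y"] mult_I_bounds pos by simp_all
  \<comment> \<open>Strictness of \<open>mult_I1\<close> beyond 1 forces both divisors to be
    1.\<close>
  with \<open>x \<noteq> y\<close> show False
    using mult_I1_eq_1_iff[OF assms(1)] pos by blast
qed

theorem theorem3p7: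
  fixes n :: nat and h :: "nat \<Rightarrow> real"
  assumes "n > 1" and "h \<in> mult_I"
  shows "pseudometric_on (UNIV :: int set) (dist_mult h n) \<and>
         pseudometric_on (int ` divisors_of n) (dist_mult h n) \<and>
         (h \<in> mult_I1 \<longrightarrow> metric_on (int ` divisors_of n) (dist_mult h n))"
proof -
  have Z: "pseudometric_on (UNIV :: int set) (dist_mult h n)"
    using pseudometric_dist_mult assms by simp
  then have D: "pseudometric_on (int ` divisors_of n) (dist_mult h n)"
    by (rule pseudometric_on_subset) simp
  have "metric_on (int ` divisors_of n) (dist_mult h n)" if "h \<in> mult_I1"
    using D dist_mult_eq_0_imp_eq[OF that] unfolding metric_on_def by blast
  with Z D show ?thesis by blast
qed

end
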